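(* For any integer $t\ge 2$, we have $F(r,t)\ge \binom{(tr-2)/2}{r-1}\cdot 2^{r-1}$ for every even integer $r\ge 2$, and $F(r,t)\ge \binom{(tr-t-2)/2}{r-2}\cdot 2^{r-2}$ for every odd integer $r\ge 3$.
   Context: An $r$-uniform hypergraph is a hypergraph all of whose edges have exactly $r$ vertices. A matching is a collection of pairwise disjoint edges; its size is the number of edges. Given matchings $M_1,\dots,M_N$ in the same hypergraph, a rainbow matching of size $t$ consists of pairwise disjoint edges $e_1\in M_{i_1},\dots,e_t\in M_{i_t}$ with distinct indices $i_1,\dots,i_t\in\{1,\dots,N\}$. $F(r,t)$ denotes the maximum possible number $N$ of matchings $M_1,\dots,M_N$ of size $t$ in some $r$-uniform hypergraph such that there is no rainbow matching of size $t$. *)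

theory Defs
  imports Main "HOL-Library.Disjoint_Sets" "HOL-Library.Extended_Nat"
begin

definition uniform_hypergraph :: "nat \<Rightarrow> 'a set \<Rightarrow> 'a set set \<Rightarrow> bool" where
  "uniform_hypergraph r V E \<longleftrightarrow> finite V \<and> E \<subseteq> Pow V \<and> (\<forall>e\<in>E. card e = r)"

definition matching_of_size :: "'a set set \<Rightarrow> nat \<Rightarrow> 'a set set \<Rightarrow> bool" where
  "matching_of_size E t M \<longleftrightarrow> M \<subseteq> E \<and> disjoint M \<and> card M = t"

definition has_rainbow_matching :: "nat \<Rightarrow> (nat \<Rightarrow> 'a set set) \<Rightarrow> nat \<Rightarrow> bool" where
  "has_rainbow_matching N M t \<longleftrightarrow>
     (\<exists>(i :: nat \<Rightarrow> nat) (e :: nat \<Rightarrow> 'a set).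
        i ` {1..t} \<subseteq> {1..N} \<and> inj_on i {1..t} \<and>
        (\<forall>j\<in>{1..t}. e j \<in> M (i j)) \<and> disjoint_family_on e {1..t})"

(* The matchings M 1, ..., M N form an indexed family, so the same matching may
   occur under several indices.  Only finitely many finite edges are involved,
   so taking natural numbers as vertices loses no generality. *)
definition rainbow_free_number :: "nat \<Rightarrow> nat \<Rightarrow> nat \<Rightarrow> bool" where
  "rainbow_free_number r t N \<longleftrightarrow>
     (\<exists>(V :: nat set) E (M :: nat \<Rightarrow> nat set set).
        uniform_hypergraph r V E \<and>
        (\<forall>k\<in>{1..N}. matching_of_size E t (M k)) \<and>
        \<not> has_rainbow_matching N M t)"

(* The maximum is taken as a supremum in enat: a finite value is attained, and
   the value is infinite, rather than unspecified, if no maximum exists. *)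
definition F :: "nat \<Rightarrow> nat \<Rightarrow> enat" where
  "F r t = Sup (enat ` {N. rainbow_free_number r t N})"

end

theory Submission
  imports Defs
begin

text \<open>
  For even \<open>r\<close>, group \<open>t r\<close> vertices into pairs \<open>{2 i, 2 i + 1}\<close>. Every \<open>r\<close>-set \<open>e\<close> that contains
  \<open>0\<close> and meets each pair at most once is put into one perfect matching, together with the set
  \<open>e'\<close> of the partners of its vertices and \<open>t - 2\<close> unions of pairs. A rainbow matching of size \<open>t\<close>
  covers all vertices; let \<open>e\<close> be its edge through \<open>0\<close>. A partner of a vertex of \<open>e\<close> lies neither in
  a union of pairs nor in another edge through \<open>0\<close>, so all partners lie in the edge through \<open>1\<close>,
  which is therefore \<open>e'\<close>. But \<open>e\<close> and \<open>e'\<close> both belong to one matching only, the same one. For odd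
  \<open>r\<close>, add a private new vertex to each edge of the construction for \<open>r - 1\<close>.
\<close>

section \<open>Vertex pairs, their transversals and their unions\<close>

text \<open>A pair is coded by the common value \<open>x div 2\<close> of its two vertices.
  \<open>B\<close> picks the side inside each pair of \<open>A\<close>; its elements outside
  \<open>A\<close> have no effect.\<close>

definition transversal :: "nat set \<Rightarrow> nat set \<Rightarrow> nat set" where
  "transversal A B = {x. x div 2 \<in> A \<and> (odd x \<longleftrightarrow> x div 2 \<in> B)}"

definition pairs_union :: "nat set \<Rightarrow> nat set" where
  "pairs_union C = {x. x div 2 \<in> C}"

lemma card_transversal: "card (transversal A B) = card A"
proof -
  have "bij_betw (\<lambda>x. x div 2) (transversal A B) A"
    unfolding bij_betw_def
  proof
    show "inj_on (\<lambda>x. x div 2) (transversal A B)"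
      by (rule inj_onI) (auto simp: transversal_def elim!: oddE evenE)
    have "a \<in> (\<lambda>x. x div 2) ` transversal A B" if "a \<in> A" for a
      by (rule image_eqI[where x = "2 * a + of_bool (a \<in> B)"])
        (use that in \<open>auto simp: transversal_def\<close>)
    then show "(\<lambda>x. x div 2) ` transversal A B = A"
      by (auto simp: transversal_def)
  qed
  then show ?thesis
    by (rule bij_betw_same_card)
qed

lemma finite_transversal:
  assumes "finite A"
  shows "finite (transversal A B)"
proof -
  have "transversal A B \<subseteq> (\<lambda>a. 2 * a) ` A \<union> (\<lambda>a. 2 * a + 1) ` A"
  proof
    fix x assume "x \<in> transversal A B"
    then have "x div 2 \<in> A" by (simp add: transversal_def)
    moreover have "x = 2 * (x div 2) \<or> x = 2 * (x div 2) + 1" by presburger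
    ultimately show "x \<in> (\<lambda>a. 2 * a) ` A \<union> (\<lambda>a. 2 * a + 1) ` A" by blast
  qed
  then show ?thesis
    using assms by (meson finite_UnI finite_imageI finite_subset)
qed

lemma card_pairs_union:
  assumes "finite C"
  shows "card (pairs_union C) = 2 * card C"
proof -
  have "pairs_union C = transversal C {} \<union> transversal C C"
    by (auto simp: pairs_union_def transversal_def)
  moreover have "transversal C {} \<inter> transversal C C = {}"
    by (auto simp: transversal_def)
  ultimately show ?thesis
    using assms by (simp add: card_Un_disjoint finite_transversal card_transversal)
qed

lemma inj_pairs_union: "inj pairs_union"
proof (rule injI)
  fix C D assume "pairs_union C = pairs_union D"
  then have "(2 * c) \<in> pairs_union C \<longleftrightarrow> (2 * c) \<in> pairs_union D" for c by simp
  then show "C = D" by (auto simp: pairs_union_def)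
qed

text \<open>Testing the even and the odd vertex of each pair separately recovers the pairs met and
  the side chosen in them. Only the trace of \<open>B\<close> on \<open>A\<close> can be
  recovered.\<close>

lemma transversal_eqD:
  assumes "transversal A B = transversal A' B'"
  shows "A = A'" and "A \<inter> B = A' \<inter> B'"
proof -
  have *: "2 * c \<in> transversal A B \<longleftrightarrow> 2 * c \<in> transversal A' B'"
    "2 * c + 1 \<in> transversal A B \<longleftrightarrow> 2 * c + 1 \<in> transversal A' B'" for c
    using assms by simp_all
  have **: "c \<in> A \<and> c \<notin> B \<longleftrightarrow> c \<in> A' \<and> c \<notin> B'" "c \<in> A \<and> c \<in> B \<longleftrightarrow> c \<in> A' \<and> c \<in> B'" for c
    using *[of c] by (simp_all add: transversal_def)
  show "A = A'" "A \<inter> B = A' \<inter> B'" using ** by blast+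
qed

section \<open>Partitions into equal blocks and the number of indices\<close>

lemma equipartition_exists:
  fixes S :: "'a set"
  assumes "finite S" "card S = k * n" "n > 0"
  shows "\<exists>P. \<Union>P = S \<and> disjoint P \<and> card P = k \<and> (\<forall>C\<in>P. card C = n)"
  using assms
proof (induction k arbitrary: S)
  case 0
  then show ?case by (intro exI[of _ "{}"]) (auto simp: disjoint_def)
next
  case (Suc k)
  then have "n \<le> card S" by simp
  then obtain C where C: "C \<subseteq> S" "card C = n"
    by (meson obtain_subset_with_card_n)
  have "card (S - C) = k * n"
    using C Suc.prems by (simp add: card_Diff_subset finite_subset)
  then obtain P where P: "\<Union>P = S - C" "disjoint P" "card P = k" "\<forall>D\<in>P. card D = n"
    using Suc.IH[of "S - C"] Suc.prems by auto
  \<comment> \<open>As \<open>n > 0\<close>, the new block is nonempty and hence differs from all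
    old blocks, which avoid it; so the number of blocks really grows by one.\<close>
  have "C \<noteq> {}" using C Suc.prems by auto
  then have "C \<notin> P" using P(1) by blast
  have "finite P" using P(1) Suc.prems(1) by (metis finite_Diff finite_UnionD)
  show ?case
  proof (intro exI[of _ "insert C P"] conjI)
    show "\<Union>(insert C P) = S" using C P(1) by auto
    show "disjoint (insert C P)" using P(1,2) by (auto simp: disjoint_def)
    show "card (insert C P) = Suc k" using \<open>C \<notin> P\<close> \<open>finite P\<close> P(3) by simp
    show "\<forall>D\<in>insert C P. card D = n" using C P(4) by auto
  qed
qed

text \<open>This counts the matchings: first choose the pairs that an edge through \<open>0\<close>
  meets besides pair \<open>0\<close>, then the side taken in each.\<close>

lemma card_choose_with_subset:
  assumes "finite S"
  shows "card (SIGMA A:{A. A \<subseteq> S \<and> card A = k}. Pow A) = (card S choose k) * 2 ^ k"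
proof -
  let ?K = "{A. A \<subseteq> S \<and> card A = k}"
  have "finite ?K" using assms by simp
  moreover have "\<forall>A\<in>?K. finite (Pow A)" using assms finite_subset by auto
  ultimately have "card (SIGMA A:?K. Pow A) = (\<Sum>A\<in>?K. card (Pow A))"
    by (rule card_SigmaI)
  also have "\<dots> = (\<Sum>A\<in>?K. 2 ^ k)"
    by (rule sum.cong) (use assms in \<open>auto simp: card_Pow finite_subset\<close>)
  finally show ?thesis
    using assms by (simp add: n_subsets)
qed

section \<open>The construction for even uniformity\<close>

lemma rainbow_free_even:
  assumes t: "t \<ge> 2" and s: "s > 0" and N: "N = ((t * s - 1) choose (2 * s - 1)) * 2 ^ (2 * s - 1)"
  shows "rainbow_free_number (2 * s) t N"
proof -
  \<comment> \<open>Pair \<open>0\<close> is left out: its vertex \<open>0\<close> is prescribed, so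
    only \<open>2 * s - 1\<close> further pairs and their sides are free.\<close>
  define S where "S = {1..<t * s}"
  define I where "I = (SIGMA A:{A. A \<subseteq> S \<and> card A = 2 * s - 1}. Pow A)"
  obtain u where "t = u + 2" using t by (metis le_add_diff_inverse2)
  then have ts: "t * s = (t - 2) * s + 2 * s" "t * s > 0"
    using s by (simp_all add: algebra_simps)
  have "finite S" by (simp add: S_def)
  have cardI: "card I = N"
    using card_choose_with_subset[of S "2 * s - 1"] by (simp add: I_def N S_def)
  have "finite I"
    unfolding I_def using \<open>finite S\<close> finite_subset by (intro finite_SigmaI) auto
  then obtain \<phi> where \<phi>: "bij_betw \<phi> {1..N} I"
    using ex_bij_betw_nat_finite_1[of I] cardI by auto
  have index: "finite A \<and> card (insert 0 A) = 2 * s \<and> insert 0 A \<subseteq> {..<t * s} \<and> 0 \<notin> A \<and> B \<subseteq> A"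
    if "(A, B) \<in> I" for A B
  proof -
    have A: "A \<subseteq> S" "card A = 2 * s - 1" "B \<subseteq> A" using that by (auto simp: I_def)
    moreover have "finite A" using A(1) \<open>finite S\<close> finite_subset by blast
    moreover have "0 \<notin> A" using A(1) by (auto simp: S_def)
    ultimately show ?thesis using s ts(2) by (auto simp: S_def)
  qed
  \<comment> \<open>The pairs missed by the two transversals number \<open>(t - 2) * s\<close>.
    Blocks of \<open>s\<close> pairs become edges with \<open>2 * s\<close> vertices.\<close>
  have "\<forall>p\<in>I. \<exists>P. \<Union>P = {..<t * s} - insert 0 (fst p) \<and> disjoint P \<and> card P = t - 2 \<and>
      (\<forall>C\<in>P. card C = s)"
  proof (intro ballI equipartition_exists)
    fix p assume "p \<in> I"
    then have "(fst p, snd p) \<in> I" by simp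
    from index[OF this] show "card ({..<t * s} - insert 0 (fst p)) = (t - 2) * s"
      using ts by (subst card_Diff_subset) auto
  qed (use s in auto)
  then obtain P where P: "\<forall>p\<in>I. \<Union>(P p) = {..<t * s} - insert 0 (fst p) \<and> disjoint (P p) \<and>
      card (P p) = t - 2 \<and> (\<forall>C\<in>P p. card C = s)"
    by (rule bchoice[THEN exE])
  \<comment> \<open>\<open>L p\<close> is the edge through \<open>0\<close> and \<open>R p\<close>
    the set of its partners. As \<open>0\<close> is not in \<open>B\<close>, \<open>L p\<close>
    takes vertex \<open>0\<close>; complementing \<open>B\<close> in \<open>insert 0 A\<close> flips
    every side, so \<open>R p\<close> takes vertex \<open>1\<close>.\<close>
  define L where "L = (\<lambda>(A, B). transversal (insert 0 A) B)"
  define R where "R = (\<lambda>(A, B). transversal (insert 0 A) (insert 0 A - B))"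
  define M where "M p = insert (L p) (insert (R p) (pairs_union ` P p))" for p
  define V where "V = {..<t * (2 * s)}"
  define E where "E = {e. e \<subseteq> V \<and> card e = 2 * s}"
  have VI: "x \<in> V \<longleftrightarrow> x div 2 < t * s" for x
    unfolding V_def by auto
  have zero: "0 \<in> L p \<and> 1 \<notin> L p \<and> 0 \<notin> R p \<and> 1 \<in> R p \<and> L p \<inter> R p = {} \<and>
      card (L p) = 2 * s \<and> card (R p) = 2 * s" if "p \<in> I" for p
    using that index[of "fst p" "snd p"]
    by (cases p) (auto simp: L_def R_def card_transversal, auto simp: transversal_def)
  have P_sub: "C \<subseteq> {..<t * s} - insert 0 (fst p)" "finite C" if "p \<in> I" "C \<in> P p" for p C
  proof -
    show "C \<subseteq> {..<t * s} - insert 0 (fst p)"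
      using bspec[OF P \<open>p \<in> I\<close>] Union_upper[OF \<open>C \<in> P p\<close>] by simp
    then show "finite C" by (meson finite_Diff finite_lessThan finite_subset)
  qed
  have pairs: "0 \<notin> e \<and> 1 \<notin> e" if "p \<in> I" "e \<in> pairs_union ` P p" for p e
    using that P_sub(1) by (fastforce simp: pairs_union_def)
  have matching: "matching_of_size E t (M p)" if "p \<in> I" for p
  proof -
    obtain A B where p: "p = (A, B)" by (cases p)
    note P' = bspec[OF P that] and P_sub' = P_sub[OF that]
      and index' = index[OF that[unfolded p]]
    have "\<Union>(P p) = {..<t * s} - insert 0 (fst p)" using P' by simp
    then have finP: "finite (P p)"
      by (metis finite_Diff finite_UnionD finite_lessThan)
    have sub: "e \<in> E" if "e \<in> M p" for e
    proof -
      consider "e = L p" | "e = R p" | C where "C \<in> P p" "e = pairs_union C"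
        using \<open>e \<in> M p\<close> by (auto simp: M_def)
      then show ?thesis
      proof cases
        case 1
        have "L p \<subseteq> V"
          using index' unfolding p L_def transversal_def by (auto simp: VI)
        then show ?thesis using 1 zero[OF \<open>p \<in> I\<close>] by (simp add: E_def)
      next
        case 2
        have "R p \<subseteq> V"
          using index' unfolding p R_def transversal_def by (auto simp: VI)
        then show ?thesis using 2 zero[OF \<open>p \<in> I\<close>] by (simp add: E_def)
      next
        case 3
        then have "pairs_union C \<subseteq> V"
          using P_sub'(1) by (fastforce simp: VI pairs_union_def)
        moreover have "card (pairs_union C) = 2 * s"
          using 3 P' P_sub'(2) by (simp add: card_pairs_union)
        ultimately show ?thesis using 3 by (simp add: E_def)
      qed
    qed
    have disj: "(L p \<union> R p) \<inter> pairs_union C = {}" if "C \<in> P p" for C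
    proof -
      have "C \<inter> insert 0 A = {}" using P_sub'(1)[OF that] p by auto
      then show ?thesis
        unfolding p L_def R_def transversal_def pairs_union_def by auto
    qed
    have disjP: "pairs_union C \<inter> pairs_union D = {}" if "C \<in> P p" "D \<in> P p" "C \<noteq> D" for C D
    proof -
      have "C \<inter> D = {}" using that P' by (simp add: disjoint_def)
      then show ?thesis by (auto simp: pairs_union_def)
    qed
    have "disjoint (pairs_union ` P p)"
      using disjP by (intro disjoint_family_on_disjoint_image) (simp add: disjoint_family_on_def)
    then have "disjoint (M p)"
      unfolding M_def pairwise_insert disjnt_def using zero[OF that] disj by blast
    moreover have "card (M p) = t"
    proof -
      have "L p \<notin> pairs_union ` P p" "R p \<notin> pairs_union ` P p" "L p \<noteq> R p"
        using zero[OF that] pairs[OF that] by auto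
      moreover have "card (pairs_union ` P p) = t - 2"
        using P' inj_pairs_union by (metis card_image inj_on_subset subset_UNIV)
      ultimately show ?thesis
        using finP t by (simp add: M_def)
    qed
    ultimately show ?thesis
      using sub by (auto simp: matching_of_size_def)
  qed
  have "\<not> has_rainbow_matching N (\<lambda>k. M (\<phi> k)) t"
  proof
    assume "has_rainbow_matching N (\<lambda>k. M (\<phi> k)) t"
    then obtain i e where i: "i ` {1..t} \<subseteq> {1..N}" "inj_on i {1..t}"
      and e: "\<And>j. j \<in> {1..t} \<Longrightarrow> e j \<in> M (\<phi> (i j))" and disj: "disjoint_family_on e {1..t}"
      unfolding has_rainbow_matching_def by blast
    define p where "p j = \<phi> (i j)" for j
    have p: "p j \<in> I" if "j \<in> {1..t}" for j
      using that i(1) \<phi> unfolding p_def by (meson bij_betwE image_subset_iff)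
    have inj_p: "inj_on p {1..t}"
      using comp_inj_on[OF i(2) inj_on_subset[OF bij_betw_imp_inj_on[OF \<phi>] i(1)]]
      by (simp add: p_def[abs_def] comp_def)
    have eM: "e j = L (p j) \<or> e j = R (p j) \<or> e j \<in> pairs_union ` P (p j)" if "j \<in> {1..t}" for j
      using e[OF that] by (auto simp: M_def p_def)
    have eE: "e j \<subseteq> V" "card (e j) = 2 * s" if "j \<in> {1..t}" for j
      using matching[OF p[OF that]] e[OF that] by (auto simp: matching_of_size_def E_def p_def)
    have fin: "finite (e j)" if "j \<in> {1..t}" for j
      using eE(1)[OF that] unfolding V_def by (meson finite_lessThan finite_subset)
    \<comment> \<open>The \<open>t\<close> disjoint edges have \<open>t * (2 * s)\<close> vertices
      in total, as many as \<open>V\<close>, so they exhaust it.\<close>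
    have "card (\<Union>j\<in>{1..t}. e j) = (\<Sum>j\<in>{1..t}. card (e j))"
      using fin disj unfolding disjoint_family_on_def by (intro card_UN_disjoint) auto
    also have "\<dots> = card V" using eE(2) by (simp add: V_def)
    finally have cover: "(\<Union>j\<in>{1..t}. e j) = V"
      using eE(1) by (intro card_subset_eq UN_least) (simp_all add: V_def)
    have uniq: "j = k" if "x \<in> e j" "x \<in> e k" "j \<in> {1..t}" "k \<in> {1..t}" for x j k
      using disj that unfolding disjoint_family_on_def by blast
    have "0 \<in> V" "1 \<in> V" using ts(2) by (simp_all add: VI)
    then obtain a b where a: "a \<in> {1..t}" "0 \<in> e a" and b: "b \<in> {1..t}" "1 \<in> e b"
      using cover by blast
    have ea: "e a = L (p a)"
      using eM[OF a(1)] a zero[OF p] pairs[OF p] by blast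
    have eb: "e b = R (p b)"
      using eM[OF b(1)] b zero[OF p] pairs[OF p] by blast
    obtain A B where AB: "p a = (A, B)" by (cases "p a")
    obtain A' B' where AB': "p b = (A', B')" by (cases "p b")
    note index_a = index[OF p[OF a(1), unfolded AB]]
      and index_b = index[OF p[OF b(1), unfolded AB']]
    have "R (p a) \<subseteq> R (p b)"
    proof
      fix x assume x: "x \<in> R (p a)"
      \<comment> \<open>\<open>y\<close> is the partner of \<open>x\<close>; flipping sides moves it
        from \<open>R (p a)\<close> into \<open>L (p a)\<close>.\<close>
      define y where "y = (if even x then x + 1 else x - 1)"
      have y: "y div 2 = x div 2" "odd y \<longleftrightarrow> even x"
        by (auto simp: y_def elim!: oddE)
      then have "y \<in> L (p a)"
        using x by (auto simp: AB L_def R_def transversal_def)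
      have "x \<in> V"
        using x index_a by (auto simp: AB R_def transversal_def VI)
      then obtain c where c: "c \<in> {1..t}" "x \<in> e c" using cover by blast
      \<comment> \<open>The edge \<open>e c\<close> covering \<open>x\<close> is not
        \<open>e a\<close>. If it were an \<open>L\<close>, it would share \<open>0\<close> with
        \<open>e a\<close>; if a union of pairs, it would share \<open>y\<close>. So it is an
        \<open>R\<close>, contains \<open>1\<close>, and must be \<open>e b\<close>.\<close>
      have "x \<notin> e a" using x zero[OF p[OF a(1)]] ea by blast
      then have "c \<noteq> a" using c by blast
      then have "e c \<noteq> L (p c)" using uniq[of 0 c a] a c zero[OF p] by blast
      moreover have "e c \<notin> pairs_union ` P (p c)"
      proof
        assume "e c \<in> pairs_union ` P (p c)"
        then obtain C where "e c = pairs_union C" by blast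
        then have "y \<in> e c" using c(2) y(1) by (simp add: pairs_union_def)
        then show False using uniq[of y c a] a c \<open>y \<in> L (p a)\<close> ea \<open>c \<noteq> a\<close> by simp
      qed
      ultimately have "e c = R (p c)" using eM[OF c(1)] by blast
      then have "c = b" using uniq[of 1 c b] b c zero[OF p] by blast
      then show "x \<in> R (p b)" using c eb by simp
    qed
    \<comment> \<open>Both sets have \<open>2 * s\<close> elements, so the inclusion is an
      equality.\<close>
    moreover have "finite (R (p b))"
      using fin[OF b(1)] eb by simp
    ultimately have "R (p a) = R (p b)"
      using zero[OF p] a b by (metis card_subset_eq)
    \<comment> \<open>The index is read off from \<open>R\<close>: removing \<open>0\<close> gives
      \<open>A\<close>, and complementing the recovered sides gives \<open>B\<close>.\<close>
    then have eq: "insert 0 A = insert 0 A'"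
      "insert 0 A \<inter> (insert 0 A - B) = insert 0 A' \<inter> (insert 0 A' - B')"
      unfolding AB AB' R_def by (auto dest: transversal_eqD)
    then have "A = A'" using index_a index_b by (simp add: insert_ident)
    moreover from this have "B = B'" using eq(2) index_a index_b by blast
    \<comment> \<open>Rainbow positions with the same index coincide, so one edge would contain both
      \<open>0\<close> and \<open>1\<close>, whereas \<open>L (p a)\<close> avoids
      \<open>1\<close>.\<close>
    ultimately have "a = b" using inj_onD[OF inj_p _ a(1) b(1)] AB AB' by simp
    then show False using zero[OF p] a b ea by auto
  qed
  moreover have "matching_of_size E t (M (\<phi> k))" if "k \<in> {1..N}" for k
    using matching[OF bij_betw_apply[OF \<phi> that]] .
  moreover have "uniform_hypergraph (2 * s) V E"
    by (auto simp: uniform_hypergraph_def E_def V_def)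
  ultimately show ?thesis
    unfolding rainbow_free_number_def by (intro exI[of _ V] exI[of _ E] exI) auto
qed

section \<open>Raising the uniformity by one\<close>

lemma rainbow_free_Suc:
  assumes "rainbow_free_number r t N"
  shows "rainbow_free_number (Suc r) t N"
proof -
  obtain V E and M :: "nat \<Rightarrow> nat set set" where hyp: "uniform_hypergraph r V E"
    and M: "\<And>k. k \<in> {1..N} \<Longrightarrow> matching_of_size E t (M k)"
    and free: "\<not> has_rainbow_matching N M t"
    using assms unfolding rainbow_free_number_def by blast
  have V: "finite V" "\<And>e. e \<in> E \<Longrightarrow> e \<subseteq> V \<and> finite e \<and> card e = r" and "finite E"
    using hyp by (auto simp: uniform_hypergraph_def intro: finite_subset)
  obtain g0 :: "nat set \<Rightarrow> nat" where g0: "inj_on g0 E"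
    using \<open>finite E\<close> finite_imp_inj_to_nat_seg by metis
  \<comment> \<open>The shift puts all new vertices above \<open>V\<close>; inserting
    \<open>0\<close> keeps the maximum meaningful when \<open>V\<close> is empty.\<close>
  define g where "g e = g0 e + Suc (Max (insert 0 V))" for e
  have g: "g e \<notin> V" for e
  proof
    assume "g e \<in> V"
    then have "g e \<le> Max (insert 0 V)" using V(1) by simp
    then show False by (simp add: g_def)
  qed
  have inj_g: "e = e'" if "g e = g e'" "e \<in> E" "e' \<in> E" for e e'
    using that g0 by (auto simp: g_def dest: inj_onD)
  \<comment> \<open>The new vertex depends on the edge alone, not on the matching containing it.
    Intersecting with \<open>V\<close> undoes the extension.\<close>
  define h where "h e = insert (g e) e" for e
  have h: "h e \<inter> V = e" if "e \<in> E" for e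
    using V(2)[OF that] g by (auto simp: h_def)
  have "inj_on h E" using h by (metis inj_onI)
  have disj_h: "h e \<inter> h e' = {}" if "e \<in> E" "e' \<in> E" "e \<noteq> e'" "e \<inter> e' = {}" for e e'
    using that V(2)[OF that(1)] V(2)[OF that(2)] g inj_g unfolding h_def by blast
  have "uniform_hypergraph (Suc r) (V \<union> g ` E) (h ` E)"
    unfolding uniform_hypergraph_def
  proof (intro conjI ballI)
    show "finite (V \<union> g ` E)" using V \<open>finite E\<close> by simp
    show "h ` E \<subseteq> Pow (V \<union> g ` E)" using V(2) by (auto simp: h_def)
    fix e assume "e \<in> h ` E"
    then obtain d where d: "d \<in> E" "e = h d" by auto
    then have "g d \<notin> d" using V(2) g by blast
    then show "card e = Suc r" using d V(2) by (simp add: h_def)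
  qed
  moreover have "matching_of_size (h ` E) t (h ` M k)" if "k \<in> {1..N}" for k
  proof -
    have Mk: "M k \<subseteq> E" "disjoint (M k)" "card (M k) = t"
      using M[OF that] by (auto simp: matching_of_size_def)
    have "disjoint (h ` M k)"
      unfolding disjoint_def
    proof (intro ballI impI)
      fix a b assume "a \<in> h ` M k" "b \<in> h ` M k" "a \<noteq> b"
      then obtain c d where "c \<in> M k" "d \<in> M k" "a = h c" "b = h d" "c \<noteq> d" by auto
      moreover from this have "c \<inter> d = {}" using Mk(2) by (simp add: disjoint_def)
      ultimately show "a \<inter> b = {}" using disj_h Mk(1) by blast
    qed
    moreover have "card (h ` M k) = t"
      using Mk \<open>inj_on h E\<close> by (metis card_image inj_on_subset)
    ultimately show ?thesis using Mk by (auto simp: matching_of_size_def)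
  qed
  moreover have "\<not> has_rainbow_matching N (\<lambda>k. h ` M k) t"
  proof
    assume "has_rainbow_matching N (\<lambda>k. h ` M k) t"
    then obtain i e where i: "i ` {1..t} \<subseteq> {1..N}" "inj_on i {1..t}"
      and e: "\<And>j. j \<in> {1..t} \<Longrightarrow> e j \<in> h ` M (i j)" and disj: "disjoint_family_on e {1..t}"
      unfolding has_rainbow_matching_def by blast
    \<comment> \<open>Deleting the new vertices keeps the indices and the disjointness, so a rainbow
      matching of extended edges yields one of original edges.\<close>
    have "e j \<inter> V \<in> M (i j)" if "j \<in> {1..t}" for j
    proof -
      have "M (i j) \<subseteq> E" using M i(1) that by (auto simp: matching_of_size_def image_subset_iff)
      then show ?thesis using e[OF that] h by auto
    qed
    moreover have "disjoint_family_on (\<lambda>j. e j \<inter> V) {1..t}"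
      using disj by (auto simp: disjoint_family_on_def)
    ultimately have "has_rainbow_matching N M t"
      unfolding has_rainbow_matching_def using i
      by (intro exI[of _ i] exI[of _ "\<lambda>j. e j \<inter> V"]) simp
    then show False using free by contradiction
  qed
  ultimately show ?thesis
    unfolding rainbow_free_number_def
    by (intro exI[of _ "V \<union> g ` E"] exI[of _ "h ` E"] exI[of _ "\<lambda>k. h ` M k"]) simp
qed

section \<open>Lower bounds for the maximum\<close>

lemma F_ge: "rainbow_free_number r t N \<Longrightarrow> F r t \<ge> enat N"
  unfolding F_def by (intro Sup_upper) auto

theorem theorem4p18:
  fixes t :: nat
  assumes "t \<ge> 2"
  shows "(\<forall>r::nat. r \<ge> 2 \<and> even r \<longrightarrow>
            F r t \<ge> enat (((t * r - 2) div 2 choose (r - 1)) * 2 ^ (r - 1))) \<and>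
         (\<forall>r::nat. r \<ge> 3 \<and> odd r \<longrightarrow>
            F r t \<ge> enat (((t * r - t - 2) div 2 choose (r - 2)) * 2 ^ (r - 2)))"
proof (intro conjI allI impI)
  fix r :: nat assume r: "r \<ge> 2 \<and> even r"
  then obtain s where s: "r = 2 * s" "s > 0" by (auto elim!: evenE)
  have "(t * r - 2) div 2 = t * s - 1" using s by simp
  then show "F r t \<ge> enat (((t * r - 2) div 2 choose (r - 1)) * 2 ^ (r - 1))"
    using rainbow_free_even[OF assms s(2) refl] s(1) F_ge by simp
next
  fix r :: nat assume r: "r \<ge> 3 \<and> odd r"
  then obtain s where s: "r = Suc (2 * s)" "s > 0" by (auto elim!: oddE)
  \<comment> \<open>Since \<open>t * r - t = t * (2 * s)\<close>, the odd bound is the even bound at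
    \<open>r - 1\<close>.\<close>
  have "(t * r - t - 2) div 2 = t * s - 1" "r - 2 = 2 * s - 1" using s by simp_all
  then show "F r t \<ge> enat (((t * r - t - 2) div 2 choose (r - 2)) * 2 ^ (r - 2))"
    using rainbow_free_Suc[OF rainbow_free_even[OF assms s(2) refl]] s(1) F_ge by simp
qed

end
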